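(* Let $\Bbbk$ be a field (of any characteristic), let $n>1$, and let $R=\Bbbk\langle x_1,\dots,x_n\rangle$ be the free associative unital $\Bbbk$-algebra on $n$ variables. Then the algebra $D_{\Bbbk}(R)$ of differential operators on $R$ is simple.
   Context: Differential operators (Lunts–Rosenberg): for a unital associative $\Bbbk$-algebra $R$, $\mathrm{Hom}_{\Bbbk}(R,R)$ is an $R$-bimodule via $(r\varphi)(s)=r\varphi(s)$ and $(\varphi r)(s)=\varphi(rs)$. For $r\in R$ put $[\varphi,r]=\varphi r-r\varphi$. Set $D^{-1}_{\Bbbk}(R)=0$ and, for $m\ge 0$, let $D^m_{\Bbbk}(R)$ be the $R$-subbimodule of $\mathrm{Hom}_{\Bbbk}(R,R)$ generated by all $\varphi$ such that $[\varphi,r]\in D^{m-1}_{\Bbbk}(R)$ for every $r\in R$. Then $D_{\Bbbk}(R)=\bigcup_{m\ge 0}D^m_{\Bbbk}(R)$, a $\Bbbk$-algebra under composition. "Simple" means having no two-sided ideals other than $0$ and itself. *)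

theory Defs
  imports Complex_Main "HOL-Library.Cardinality" "HOL-Library.Poly_Mapping" "HOL-Algebra.Ideal"
begin

section \<open>Free associative algebras\<close>

text \<open>
  Words in the letters \<open>'v\<close>, written additively because the convolution product on
  \<open>poly_mapping\<close> is taken over a \<open>monoid_add\<close>; the monoid is not commutative.
\<close>

datatype 'v free_monoid = Word (letters: "'v list")

instantiation free_monoid :: (type) monoid_add
begin

definition zero_free_monoid :: "'a free_monoid"
  where "0 = Word []"

definition plus_free_monoid :: "'a free_monoid \<Rightarrow> 'a free_monoid \<Rightarrow> 'a free_monoid"
  where "u + w = Word (letters u @ letters w)"

instance
  by standard (simp_all add: zero_free_monoid_def plus_free_monoid_def)

end

text \<open>
  The monoid algebra of the free monoid on \<open>'v\<close>. For a finite type \<open>'v\<close> with \<open>n\<close> elements this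
  is the free associative unital algebra on \<open>n\<close> variables; the variable attached to \<open>v\<close> is
  \<open>Poly_Mapping.single (Word [v]) 1\<close>.
\<close>

type_synonym ('v, 'k) free_algebra = "'v free_monoid \<Rightarrow>\<^sub>0 'k"

definition fscale :: "'k::field \<Rightarrow> ('v, 'k) free_algebra \<Rightarrow> ('v, 'k) free_algebra"
  where "fscale c = Poly_Mapping.map ((*) c)"


section \<open>Differential operators on an associative unital algebra\<close>

locale assoc_algebra = vector_space scale
  for scale :: "'k::field \<Rightarrow> 'r::ring_1 \<Rightarrow> 'r" +
  assumes scale_mult_left: "scale c x * y = scale c (x * y)"
    and scale_mult_right: "x * scale c y = scale c (x * y)"

definition Homk :: "('k::field \<Rightarrow> 'r::ring_1 \<Rightarrow> 'r) \<Rightarrow> ('r \<Rightarrow> 'r) set"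
  where "Homk scale = {\<phi>. Vector_Spaces.linear scale scale \<phi>}"

definition lact :: "'r::ring_1 \<Rightarrow> ('r \<Rightarrow> 'r) \<Rightarrow> 'r \<Rightarrow> 'r"
  where "lact r \<phi> = (\<lambda>s. r * \<phi> s)"

definition ract :: "('r::ring_1 \<Rightarrow> 'r) \<Rightarrow> 'r \<Rightarrow> 'r \<Rightarrow> 'r"
  where "ract \<phi> r = (\<lambda>s. \<phi> (r * s))"

definition commut :: "('r::ring_1 \<Rightarrow> 'r) \<Rightarrow> 'r \<Rightarrow> 'r \<Rightarrow> 'r"
  where "commut \<phi> r = (\<lambda>s. ract \<phi> r s - lact r \<phi> s)"

text \<open>Closure under negation follows from closure under \<open>lact (- 1)\<close>.\<close>

definition subbimodule ::
  "('k::field \<Rightarrow> 'r::ring_1 \<Rightarrow> 'r) \<Rightarrow> ('r \<Rightarrow> 'r) set \<Rightarrow> bool"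
  where "subbimodule scale M \<longleftrightarrow>
    M \<subseteq> Homk scale \<and>
    (\<lambda>_. 0) \<in> M \<and>
    (\<forall>\<phi>\<in>M. \<forall>\<psi>\<in>M. (\<lambda>s. \<phi> s + \<psi> s) \<in> M) \<and>
    (\<forall>\<phi>\<in>M. \<forall>r. lact r \<phi> \<in> M \<and> ract \<phi> r \<in> M)"

definition diffop_step ::
  "('k::field \<Rightarrow> 'r::ring_1 \<Rightarrow> 'r) \<Rightarrow> ('r \<Rightarrow> 'r) set \<Rightarrow> ('r \<Rightarrow> 'r) set"
  where "diffop_step scale M =
    subbimodule scale hull {\<phi> \<in> Homk scale. \<forall>r. commut \<phi> r \<in> M}"

text \<open>The set \<open>{\<lambda>_. 0}\<close> in the base case is the module of operators of order at most \<open>- 1\<close>.\<close>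

primrec diffops_upto ::
  "('k::field \<Rightarrow> 'r::ring_1 \<Rightarrow> 'r) \<Rightarrow> nat \<Rightarrow> ('r \<Rightarrow> 'r) set"
  where
    "diffops_upto scale 0 = diffop_step scale {\<lambda>_. 0}"
  | "diffops_upto scale (Suc m) = diffop_step scale (diffops_upto scale m)"

definition diffops :: "('k::field \<Rightarrow> 'r::ring_1 \<Rightarrow> 'r) \<Rightarrow> ('r \<Rightarrow> 'r) set"
  where "diffops scale = (\<Union>m. diffops_upto scale m)"

definition diffop_ring :: "('k::field \<Rightarrow> 'r::ring_1 \<Rightarrow> 'r) \<Rightarrow> ('r \<Rightarrow> 'r) ring"
  where "diffop_ring scale =
    \<lparr>carrier = diffops scale, monoid.mult = (\<circ>), one = id,
     zero = (\<lambda>_. 0), add = (\<lambda>\<phi> \<psi> s. \<phi> s + \<psi> s)\<rparr>"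

text \<open>
  An ideal of a unital algebra is automatically stable under scalars, so no separate notion of
  algebra ideal is needed. The zero ring is not excluded.
\<close>

locale simple_ring = ring R for R (structure) +
  assumes ideal_trivial: "ideal I R \<Longrightarrow> I = {\<zero>} \<or> I = carrier R"


section \<open>The free algebra is an associative algebra\<close>

lemma lookup_fscale: "Poly_Mapping.lookup (fscale c p) w = c * Poly_Mapping.lookup p w"
  by (simp add: fscale_def Poly_Mapping.map.rep_eq when_def)

lemma fscale_eq_mult:
  fixes p :: "('v, 'k::field) free_algebra"
  shows "fscale c p = Poly_Mapping.single 0 c * p"
proof (rule poly_mapping_eqI)
  fix w :: "'v free_monoid"
  have "(\<Sum>l. Poly_Mapping.lookup (Poly_Mapping.single 0 c) l *
          (\<Sum>q. Poly_Mapping.lookup p q when w = l + q))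
      = (\<Sum>l. c * (\<Sum>q. Poly_Mapping.lookup p q when w = 0 + q) when l = (0 :: 'v free_monoid))"
    by (intro arg_cong[where f = Sum_any] ext) (auto simp: lookup_single when_def)
  then show "Poly_Mapping.lookup (fscale c p) w =
      Poly_Mapping.lookup (Poly_Mapping.single 0 c * p) w"
    by (simp add: lookup_fscale lookup_mult)
qed

lemma fscale_eq_mult_right:
  fixes p :: "('v, 'k::field) free_algebra"
  shows "fscale c p = p * Poly_Mapping.single 0 c"
proof (rule poly_mapping_eqI)
  fix w :: "'v free_monoid"
  have inner: "(\<Sum>q. Poly_Mapping.lookup (Poly_Mapping.single 0 c) q when w = l + q)
      = (c when w = l)" for l :: "'v free_monoid"
  proof -
    have "(\<Sum>q. Poly_Mapping.lookup (Poly_Mapping.single 0 c) q when w = l + q)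
      = (\<Sum>q. (c when w = l) when q = (0 :: 'v free_monoid))"
      by (intro arg_cong[where f = Sum_any] ext) (auto simp: lookup_single when_def)
    then show ?thesis by simp
  qed
  have "(\<Sum>l. Poly_Mapping.lookup p l * (c when w = l))
      = (\<Sum>l. (Poly_Mapping.lookup p l * c) when w = l)"
    by (intro arg_cong[where f = Sum_any] ext) (auto simp: when_def)
  then show "Poly_Mapping.lookup (fscale c p) w =
      Poly_Mapping.lookup (p * Poly_Mapping.single 0 c) w"
    by (simp add: lookup_fscale lookup_mult inner mult.commute)
qed

lemma assoc_algebra_fscale:
  "assoc_algebra (fscale :: 'k::field \<Rightarrow> ('v, 'k) free_algebra \<Rightarrow> ('v, 'k) free_algebra)"
proof
  fix c d :: 'k and x y :: "('v, 'k) free_algebra"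
  show "fscale c (x + y) = fscale c x + fscale c y"
    by (rule poly_mapping_eqI) (simp add: lookup_fscale lookup_add distrib_left)
  show "fscale (c + d) x = fscale c x + fscale d x"
    by (rule poly_mapping_eqI) (simp add: lookup_fscale lookup_add distrib_right)
  show "fscale c (fscale d x) = fscale (c * d) x"
    by (rule poly_mapping_eqI) (simp add: lookup_fscale mult.assoc)
  show "fscale 1 x = x"
    by (rule poly_mapping_eqI) (simp add: lookup_fscale)
  show "fscale c x * y = fscale c (x * y)"
    by (simp add: fscale_eq_mult mult.assoc)
  show "x * fscale c y = fscale c (x * y)"
    by (simp add: fscale_eq_mult_right mult.assoc)
qed

end

theory Submission
  imports Defs
begin

text \<open>
  Write \<open>[\<phi>, \<psi>]\<close> for the commutator of two \<open>k\<close>-linear endomorphisms of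
  \<open>R = k\<langle>x\<^sub>1, \<dots>, x\<^sub>n\<rangle>\<close>, and identify an element of \<open>R\<close> with left multiplication by it;
  the bimodule commutator of the definition of \<open>D(R)\<close> is then \<open>[\<phi>, r]\<close>. That \<open>D(R)\<close> is a
  ring is proved for every associative algebra, by induction on the order, from
  \<open>[\<phi>\<psi>, r] = \<phi>[\<psi>, r] + [\<phi>, r]\<psi>\<close> (\<open>diffops_below_comp\<close>).

  Simplicity rests on the operators \<open>delete J\<close>, one for every word \<open>J\<close>: the image of a word \<open>w\<close>
  is the sum of all words obtained by erasing from \<open>w\<close> a scattered subword equal to \<open>J\<close>. They
  are noncommutative analogues of divided powers of partial derivatives, and so they work in
  every characteristic. They satisfy \<open>[delete (jJ), x\<^sub>i] = \<delta>\<^sub>i\<^sub>j delete J\<close>, hence they are differential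
  operators; they commute with each other; and the constant coefficient of \<open>delete J p\<close> is the
  coefficient of \<open>J\<close> in \<open>p\<close> (\<open>lookup_delete_zero\<close>), so together they see all of \<open>p\<close>.

  Every differential operator \<open>\<phi>\<close> is killed by sufficiently many successive commutators with
  operators \<open>delete J\<close> (\<open>diffops_bracket_nilpotent\<close>). Intuitively, \<open>\<phi>\<close> is a combination of
  operators that replace scattered letters of a word by fixed words, and put fixed words at both
  ends; a commutator with \<open>delete J\<close>, for \<open>J\<close> nonempty, has to consume letters of the fixed words.
  Likewise \<open>\<phi>\<close> shortens words by a bounded amount only (\<open>diffops_degree_loss\<close>).

  Now let \<open>I\<close> be an ideal and \<open>0 \<noteq> \<phi> \<in> I\<close>. Taking commutators with operators \<open>delete J\<close> as long as
  one of them is nonzero, which comes to an end by nilpotency, we may assume that \<open>\<phi>\<close> commutes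
  with all of them. Such an operator is the sum of \<open>c\<^sub>J delete J\<close>, where \<open>c\<^sub>J\<close> is the constant
  coefficient of \<open>\<phi>(J)\<close>; the sum is finite because \<open>\<phi>\<close> does not shorten long words
  to constants. Commutators with the letters lower the length of the words \<open>J\<close> that
  occur, and lead in finitely many steps to a nonzero scalar in \<open>I\<close> (\<open>ideal_contains_id_if_commutes_with_deletes\<close>).
\<close>

section \<open>The ring of differential operators of an associative algebra\<close>

context assoc_algebra
begin

lemma mem_Homk_iff:
  "\<phi> \<in> Homk scale \<longleftrightarrow>
    (\<forall>x y. \<phi> (x + y) = \<phi> x + \<phi> y) \<and> (\<forall>c x. \<phi> (scale c x) = scale c (\<phi> x))"
  by (simp add: Homk_def Vector_Spaces.linear_iff vector_space_axioms)

lemma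
  assumes "\<phi> \<in> Homk scale"
  shows Homk_add: "\<phi> (x + y) = \<phi> x + \<phi> y"
    and Homk_scale: "\<phi> (scale c x) = scale c (\<phi> x)"
    and Homk_zero: "\<phi> 0 = 0"
    and Homk_diff: "\<phi> (x - y) = \<phi> x - \<phi> y"
    and Homk_sum: "\<phi> (sum f A) = (\<Sum>a\<in>A. \<phi> (f a))"
proof -
  interpret Vector_Spaces.linear scale scale \<phi>
    using assms by (simp add: Homk_def)
  show "\<phi> (x + y) = \<phi> x + \<phi> y" "\<phi> (scale c x) = scale c (\<phi> x)" "\<phi> 0 = 0"
    "\<phi> (x - y) = \<phi> x - \<phi> y" "\<phi> (sum f A) = (\<Sum>a\<in>A. \<phi> (f a))"
    by (rule add scale zero diff sum)+
qed

lemma Homk_comp: "\<phi> \<in> Homk scale \<Longrightarrow> \<psi> \<in> Homk scale \<Longrightarrow> \<phi> \<circ> \<psi> \<in> Homk scale"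
  by (simp add: mem_Homk_iff)

lemma Homk_mult_left: "(*) r \<in> Homk scale"
  by (simp add: mem_Homk_iff distrib_left scale_mult_right)

lemma subbimodule_Homk: "subbimodule scale (Homk scale)"
  by (auto simp: subbimodule_def mem_Homk_iff lact_def ract_def distrib_left scale_mult_right
      scale_right_distrib add_ac)

lemma subbimodule_diffop_step: "subbimodule scale (diffop_step scale M)"
proof -
  let ?G = "{\<phi> \<in> Homk scale. \<forall>r. commut \<phi> r \<in> M}"
  have "diffop_step scale M \<subseteq> Homk scale"
    unfolding diffop_step_def by (rule hull_minimal) (auto simp: subbimodule_Homk)
  then show ?thesis
    unfolding diffop_step_def hull_def subbimodule_def by auto
qed

lemma diffop_step_generator:
  "\<phi> \<in> Homk scale \<Longrightarrow> (\<And>r. commut \<phi> r \<in> M) \<Longrightarrow> \<phi> \<in> diffop_step scale M"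
  unfolding diffop_step_def by (rule hull_inc) simp

lemma diffop_step_subsetI:
  assumes "subbimodule scale S"
    and "\<And>\<phi>. \<phi> \<in> Homk scale \<Longrightarrow> (\<And>r. commut \<phi> r \<in> M) \<Longrightarrow> \<phi> \<in> S"
  shows "diffop_step scale M \<subseteq> S"
  unfolding diffop_step_def using assms by (intro hull_minimal) auto

lemma diffop_step_mono: "M \<subseteq> N \<Longrightarrow> diffop_step scale M \<subseteq> diffop_step scale N"
  unfolding diffop_step_def by (intro hull_mono) auto

text \<open>
  The shift in the index makes the zero module the first term of the filtration, so that
  inductions on the order start from a trivial case.
\<close>
definition diffops_below :: "nat \<Rightarrow> ('r \<Rightarrow> 'r) set"
  where "diffops_below n = (diffop_step scale ^^ n) {\<lambda>_. 0}"

lemma diffops_below_0: "diffops_below 0 = {\<lambda>_. 0}"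
  and diffops_below_Suc: "diffops_below (Suc n) = diffop_step scale (diffops_below n)"
  by (simp_all add: diffops_below_def)

lemma diffops_upto_eq_below: "diffops_upto scale m = diffops_below (Suc m)"
  by (induction m) (simp_all add: diffops_below_0 diffops_below_Suc)

lemma subbimodule_diffops_below: "subbimodule scale (diffops_below n)"
proof (cases n)
  case 0
  then show ?thesis
    by (auto simp: diffops_below_0 subbimodule_def mem_Homk_iff lact_def ract_def)
qed (simp add: diffops_below_Suc subbimodule_diffop_step)

lemma
  shows diffops_below_Homk: "\<phi> \<in> diffops_below n \<Longrightarrow> \<phi> \<in> Homk scale"
    and diffops_below_zero: "(\<lambda>_. 0) \<in> diffops_below n"
    and diffops_below_add:
      "\<phi> \<in> diffops_below n \<Longrightarrow> \<psi> \<in> diffops_below n \<Longrightarrow> (\<lambda>s. \<phi> s + \<psi> s) \<in> diffops_below n"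
    and diffops_below_lact: "\<phi> \<in> diffops_below n \<Longrightarrow> lact r \<phi> \<in> diffops_below n"
    and diffops_below_ract: "\<phi> \<in> diffops_below n \<Longrightarrow> ract \<phi> r \<in> diffops_below n"
  using subbimodule_diffops_below[of n] unfolding subbimodule_def by auto

lemma diffops_below_Suc_subset: "diffops_below n \<subseteq> diffops_below (Suc n)"
proof (induction n)
  case 0
  show ?case by (simp add: diffops_below_0 diffops_below_zero)
next
  case (Suc n)
  then show ?case
    using diffop_step_mono by (simp only: diffops_below_Suc)
qed

lemma diffops_below_mono: "m \<le> n \<Longrightarrow> diffops_below m \<subseteq> diffops_below n"
  using lift_Suc_mono_le[of diffops_below] diffops_below_Suc_subset by blast

lemma diffops_eq_below: "diffops scale = (\<Union>n. diffops_below n)"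
proof -
  have "diffops_below n \<subseteq> diffops_below (Suc n)" for n
    by (rule diffops_below_Suc_subset)
  then show ?thesis
    unfolding diffops_def diffops_upto_eq_below by blast
qed

text \<open>
  The sum of the orders decreases in both terms of \<open>[\<phi>\<psi>, r] = \<phi>[\<psi>, r] + [\<phi>, r]\<psi>\<close>, which settles
  the case that \<open>\<phi>\<close> and \<open>\<psi>\<close> are both among the generators of their bimodules. The bimodules
  themselves are reached in two stages, first in \<open>\<psi>\<close> for a fixed generator \<open>\<phi>\<close>, then in \<open>\<phi>\<close>.
\<close>
lemma diffops_below_comp:
  "\<phi> \<in> diffops_below m \<Longrightarrow> \<psi> \<in> diffops_below n \<Longrightarrow> \<phi> \<circ> \<psi> \<in> diffops_below (m + n)"
proof (induction "m + n" arbitrary: m n \<phi> \<psi> rule: less_induct)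
  case less
  show ?case
  proof (cases m)
    case 0
    with less.prems have "\<phi> \<circ> \<psi> = (\<lambda>_. 0)" by (auto simp: diffops_below_0)
    then show ?thesis by (simp add: diffops_below_zero)
  next
    case (Suc m')
    show ?thesis
    proof (cases n)
      case 0
      with less.prems have "\<phi> \<circ> \<psi> = (\<lambda>_. 0)"
        using Homk_zero[OF diffops_below_Homk] by (auto simp: diffops_below_0)
      then show ?thesis by (simp add: diffops_below_zero)
    next
      case (Suc n')
      have IH: "\<alpha> \<circ> \<beta> \<in> diffops_below k"
        if "\<alpha> \<in> diffops_below i" "\<beta> \<in> diffops_below j" "i + j < m + n" "i + j \<le> k" for \<alpha> \<beta> i j k
        using less.hyps[OF that(3) that(1,2)] diffops_below_mono[OF that(4)] by auto
      let ?B = "diffops_below (m + n)"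
      define S where "S = {\<alpha> \<in> Homk scale. \<forall>\<beta>\<in>diffops_below n. \<alpha> \<circ> \<beta> \<in> ?B}"
      have "subbimodule scale S"
      proof -
        have eqs: "lact r \<alpha> \<circ> \<beta> = lact r (\<alpha> \<circ> \<beta>)" "ract \<alpha> r \<circ> \<beta> = \<alpha> \<circ> lact r \<beta>"
          "(\<lambda>_. 0) \<circ> \<beta> = (\<lambda>_. 0)" "(\<lambda>s. \<alpha> s + \<gamma> s) \<circ> \<beta> = (\<lambda>s. (\<alpha> \<circ> \<beta>) s + (\<gamma> \<circ> \<beta>) s)"
          for \<alpha> \<beta> \<gamma> :: "'r \<Rightarrow> 'r" and r
          by (auto simp: lact_def ract_def)
        from subbimodule_Homk show ?thesis
          unfolding subbimodule_def S_def
          by (auto simp only: eqs diffops_below_zero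
              intro!: diffops_below_add diffops_below_lact intro: diffops_below_ract)
      qed
      moreover have "\<alpha> \<in> S" if \<alpha>: "\<alpha> \<in> Homk scale" "\<And>r. commut \<alpha> r \<in> diffops_below m'" for \<alpha>
      proof -
        have \<alpha>m: "\<alpha> \<in> diffops_below m"
          unfolding \<open>m = Suc m'\<close> diffops_below_Suc using \<alpha> by (rule diffop_step_generator)
        define T where "T = {\<beta> \<in> diffops_below n. \<alpha> \<circ> \<beta> \<in> ?B}"
        have lact_T: "lact r \<beta> \<in> T" if \<beta>: "\<beta> \<in> T" for r \<beta>
        proof -
          \<comment> \<open>Moving the generator \<open>\<alpha>\<close> past \<open>r\<close> costs a term of lower order.\<close>
          have "\<alpha> \<circ> lact r \<beta> = (\<lambda>s. lact r (\<alpha> \<circ> \<beta>) s + (commut \<alpha> r \<circ> \<beta>) s)"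
            by (auto simp: lact_def ract_def commut_def)
          moreover have "commut \<alpha> r \<circ> \<beta> \<in> ?B"
            using \<alpha>(2) \<beta> by (intro IH) (auto simp: T_def \<open>m = Suc m'\<close>)
          ultimately show ?thesis
            using \<beta> by (auto simp only: T_def mem_Collect_eq diffops_below_add diffops_below_lact)
        qed
        have "subbimodule scale T"
        proof -
          have eqs: "\<alpha> \<circ> ract \<beta> r = ract (\<alpha> \<circ> \<beta>) r" "\<alpha> \<circ> (\<lambda>_. 0) = (\<lambda>_. 0)"
            "\<alpha> \<circ> (\<lambda>s. \<beta> s + \<gamma> s) = (\<lambda>s. (\<alpha> \<circ> \<beta>) s + (\<alpha> \<circ> \<gamma>) s)"
            for \<beta> \<gamma> r
            by (auto simp: ract_def Homk_add[OF \<alpha>(1)] Homk_zero[OF \<alpha>(1)])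
          show ?thesis
            unfolding subbimodule_def
          proof (intro conjI ballI allI)
            show "T \<subseteq> Homk scale" using diffops_below_Homk by (auto simp: T_def)
            show "(\<lambda>_. 0) \<in> T" by (simp add: T_def eqs diffops_below_zero)
            fix \<beta> r assume \<beta>: "\<beta> \<in> T"
            show "lact r \<beta> \<in> T" using \<beta> by (rule lact_T)
            show "ract \<beta> r \<in> T"
              using \<beta> diffops_below_ract by (simp add: T_def eqs)
            fix \<gamma> assume "\<gamma> \<in> T"
            with \<beta> show "(\<lambda>s. \<beta> s + \<gamma> s) \<in> T"
              unfolding T_def mem_Collect_eq eqs by (blast intro: diffops_below_add)
          qed
        qed
        moreover have "\<beta> \<in> T" if \<beta>: "\<beta> \<in> Homk scale" "\<And>r. commut \<beta> r \<in> diffops_below n'" for \<beta>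
        proof -
          have \<beta>n: "\<beta> \<in> diffops_below n"
            unfolding \<open>n = Suc n'\<close> diffops_below_Suc using \<beta> by (rule diffop_step_generator)
          have "commut (\<alpha> \<circ> \<beta>) r = (\<lambda>s. (\<alpha> \<circ> commut \<beta> r) s + (commut \<alpha> r \<circ> \<beta>) s)" for r
            by (auto simp: lact_def ract_def commut_def Homk_diff[OF \<alpha>(1)])
          moreover have "\<alpha> \<circ> commut \<beta> r \<in> diffops_below (m' + n)" for r
            by (rule IH[OF \<alpha>m \<beta>(2)]) (auto simp: \<open>m = Suc m'\<close> \<open>n = Suc n'\<close>)
          moreover have "commut \<alpha> r \<circ> \<beta> \<in> diffops_below (m' + n)" for r
            by (rule IH[OF \<alpha>(2) \<beta>n]) (auto simp: \<open>m = Suc m'\<close> \<open>n = Suc n'\<close>)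
          ultimately have "commut (\<alpha> \<circ> \<beta>) r \<in> diffops_below (m' + n)" for r
            by (simp only: diffops_below_add)
          then have "\<alpha> \<circ> \<beta> \<in> ?B"
            unfolding \<open>m = Suc m'\<close> add_Suc diffops_below_Suc
            by (intro diffop_step_generator Homk_comp \<alpha> \<beta>)
          then show ?thesis using \<beta>n by (simp add: T_def)
        qed
        ultimately have "diffops_below n \<subseteq> T"
          unfolding \<open>n = Suc n'\<close> diffops_below_Suc by (intro diffop_step_subsetI) auto
        then show ?thesis using \<alpha> by (auto simp: S_def T_def)
      qed
      ultimately have "diffops_below m \<subseteq> S"
        unfolding \<open>m = Suc m'\<close> diffops_below_Suc by (intro diffop_step_subsetI) auto
      then show ?thesis using less.prems by (auto simp: S_def)
    qed
  qed
qed

lemma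
  shows diffops_Homk: "\<phi> \<in> diffops scale \<Longrightarrow> \<phi> \<in> Homk scale"
    and diffops_zero: "(\<lambda>_. 0) \<in> diffops scale"
    and diffops_lact: "\<phi> \<in> diffops scale \<Longrightarrow> lact r \<phi> \<in> diffops scale"
    and diffops_comp: "\<phi> \<in> diffops scale \<Longrightarrow> \<psi> \<in> diffops scale \<Longrightarrow> \<phi> \<circ> \<psi> \<in> diffops scale"
  unfolding diffops_eq_below UN_iff
  by (blast dest: diffops_below_Homk diffops_below_lact diffops_below_comp
      intro: diffops_below_zero)+

lemma diffops_add:
  assumes "\<phi> \<in> diffops scale" "\<psi> \<in> diffops scale"
  shows "(\<lambda>s. \<phi> s + \<psi> s) \<in> diffops scale"
proof -
  obtain m n where "\<phi> \<in> diffops_below m" "\<psi> \<in> diffops_below n"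
    using assms by (auto simp: diffops_eq_below)
  then have "\<phi> \<in> diffops_below (max m n)" "\<psi> \<in> diffops_below (max m n)"
    using diffops_below_mono[of m "max m n"] diffops_below_mono[of n "max m n"] by auto
  then show ?thesis
    unfolding diffops_eq_below using diffops_below_add by blast
qed

text \<open>
  The induction principle for differential operators: the order does not occur, because \<open>S\<close>
  takes the place of all terms of the filtration at once.
\<close>
lemma diffops_subsetI:
  assumes S: "subbimodule scale S"
    and step: "\<And>\<phi>. \<phi> \<in> Homk scale \<Longrightarrow> (\<And>r. commut \<phi> r \<in> S) \<Longrightarrow> \<phi> \<in> S"
  shows "diffops scale \<subseteq> S"
proof -
  have "diffops_below n \<subseteq> S" for n
  proof (induction n)
    case 0
    show ?case using S by (auto simp: diffops_below_0 subbimodule_def)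
  next
    case (Suc n)
    show ?case
      unfolding diffops_below_Suc
    proof (rule diffop_step_subsetI[OF S])
      fix \<phi> assume "\<phi> \<in> Homk scale" "\<And>r. commut \<phi> r \<in> diffops_below n"
      with Suc show "\<phi> \<in> S" by (auto intro!: step[of \<phi>])
    qed
  qed
  then show ?thesis by (auto simp: diffops_eq_below)
qed

lemma id_in_diffops: "id \<in> diffops scale"
proof -
  have "id \<in> diffops_below (Suc 0)"
    unfolding diffops_below_Suc
    by (rule diffop_step_generator)
      (auto simp: mem_Homk_iff commut_def lact_def ract_def diffops_below_0)
  then show ?thesis unfolding diffops_eq_below by blast
qed

lemma mult_left_in_diffops: "(*) r \<in> diffops scale"
  using diffops_lact[OF id_in_diffops, of r] by (simp add: lact_def)

lemma ring_diffop_ring: "ring (diffop_ring scale)"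
proof (rule ringI)
  have uminus: "(\<lambda>s. - \<phi> s) \<in> diffops scale" if "\<phi> \<in> diffops scale" for \<phi>
    using diffops_lact[OF that, of "- 1"] by (simp add: lact_def)
  show "abelian_group (diffop_ring scale)"
  proof (rule abelian_groupI)
    fix \<phi> assume "\<phi> \<in> carrier (diffop_ring scale)"
    then show "\<exists>\<psi>\<in>carrier (diffop_ring scale). \<psi> \<oplus>\<^bsub>diffop_ring scale\<^esub> \<phi> = \<zero>\<^bsub>diffop_ring scale\<^esub>"
      by (intro bexI[of _ "\<lambda>s. - \<phi> s"]) (simp_all add: diffop_ring_def uminus)
  qed (auto simp: diffop_ring_def diffops_add diffops_zero add.assoc add.commute)
  show "monoid (diffop_ring scale)"
    by (rule monoidI) (auto simp: diffop_ring_def diffops_comp id_in_diffops)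
qed (auto simp: diffop_ring_def fun_eq_iff Homk_add[OF diffops_Homk])

text \<open>
  The map \<open>r \<mapsto> [\<phi>, r]\<close> is linear and satisfies \<open>[\<phi>, pq] = [\<phi>, p] q + p [\<phi>, q]\<close>, so its values
  lie in a bimodule as soon as those on algebra generators do.
\<close>
lemma
  assumes M: "subbimodule scale M" and \<phi>: "\<phi> \<in> Homk scale"
  shows commut_one_mem: "commut \<phi> 1 \<in> M"
    and commut_add_mem: "commut \<phi> p \<in> M \<Longrightarrow> commut \<phi> q \<in> M \<Longrightarrow> commut \<phi> (p + q) \<in> M"
    and commut_mult_mem: "commut \<phi> p \<in> M \<Longrightarrow> commut \<phi> q \<in> M \<Longrightarrow> commut \<phi> (p * q) \<in> M"
    and commut_scale_mem: "commut \<phi> p \<in> M \<Longrightarrow> commut \<phi> (scale c p) \<in> M"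
proof -
  have one: "commut \<phi> 1 = (\<lambda>_. 0)"
    by (simp add: commut_def ract_def lact_def)
  have add: "commut \<phi> (p + q) = (\<lambda>s. commut \<phi> p s + commut \<phi> q s)" for p q
    by (simp add: commut_def ract_def lact_def distrib_right Homk_add[OF \<phi>] fun_eq_iff)
  have mult: "commut \<phi> (p * q) = (\<lambda>s. ract (commut \<phi> p) q s + lact p (commut \<phi> q) s)" for p q
    by (simp add: commut_def ract_def lact_def algebra_simps fun_eq_iff)
  have scl: "commut \<phi> (scale c p) = lact (scale c 1) (commut \<phi> p)"
    by (simp add: commut_def ract_def lact_def scale_mult_left Homk_scale[OF \<phi>]
        scale_right_diff_distrib fun_eq_iff)
  note M' = M[unfolded subbimodule_def]
  show "commut \<phi> 1 \<in> M" using M' by (simp add: one)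
  show "commut \<phi> (p + q) \<in> M" if "commut \<phi> p \<in> M" "commut \<phi> q \<in> M"
    using M' that by (simp add: add)
  show "commut \<phi> (p * q) \<in> M" if "commut \<phi> p \<in> M" "commut \<phi> q \<in> M"
    using M' that by (simp add: mult)
  show "commut \<phi> (scale c p) \<in> M" if "commut \<phi> p \<in> M"
    using M' that by (simp add: scl)
qed

definition bracket :: "('r \<Rightarrow> 'r) \<Rightarrow> ('r \<Rightarrow> 'r) \<Rightarrow> 'r \<Rightarrow> 'r"
  where "bracket \<phi> \<psi> = (\<lambda>s. \<phi> (\<psi> s) - \<psi> (\<phi> s))"

lemma commut_eq_bracket: "commut \<phi> r = bracket \<phi> ((*) r)"
  by (simp add: commut_def ract_def lact_def bracket_def)

lemma bracket_Homk: "\<phi> \<in> Homk scale \<Longrightarrow> \<psi> \<in> Homk scale \<Longrightarrow> bracket \<phi> \<psi> \<in> Homk scale"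
  by (simp add: bracket_def mem_Homk_iff scale_right_diff_distrib)

lemma bracket_zero:
  "\<phi> \<in> Homk scale \<Longrightarrow> bracket \<phi> (\<lambda>_. 0) = (\<lambda>_. 0)"
  by (simp add: bracket_def Homk_zero)

text \<open>
  The Jacobi identity.
\<close>
lemma bracket_bracket:
  assumes "\<phi> \<in> Homk scale" "\<psi> \<in> Homk scale" "\<chi> \<in> Homk scale"
  shows "bracket (bracket \<phi> \<psi>) \<chi> =
    (\<lambda>s. bracket (bracket \<phi> \<chi>) \<psi> s + bracket \<phi> (bracket \<psi> \<chi>) s)"
  by (simp add: bracket_def fun_eq_iff Homk_diff[OF assms(1)] Homk_diff[OF assms(2)]
      Homk_diff[OF assms(3)])

lemma bracket_comp:
  assumes "\<delta> \<in> Homk scale" "\<phi> \<in> Homk scale"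
  shows "bracket \<delta> (\<phi> \<circ> \<psi>) = (\<lambda>s. (bracket \<delta> \<phi> \<circ> \<psi>) s + (\<phi> \<circ> bracket \<delta> \<psi>) s)"
  by (simp add: bracket_def fun_eq_iff Homk_diff[OF assms(2)])

lemma
  assumes "ideal I (diffop_ring scale)"
  shows diffop_ideal_subset: "I \<subseteq> diffops scale"
    and diffop_ideal_comp_left: "\<phi> \<in> I \<Longrightarrow> \<psi> \<in> diffops scale \<Longrightarrow> \<psi> \<circ> \<phi> \<in> I"
    and diffop_ideal_bracket_left: "\<phi> \<in> I \<Longrightarrow> \<psi> \<in> diffops scale \<Longrightarrow> bracket \<psi> \<phi> \<in> I"
    and diffop_ideal_bracket_right: "\<phi> \<in> I \<Longrightarrow> \<psi> \<in> diffops scale \<Longrightarrow> bracket \<phi> \<psi> \<in> I"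
proof -
  interpret ideal I "diffop_ring scale" by fact
  show sub: "I \<subseteq> diffops scale"
    using a_subset by (simp add: diffop_ring_def)
  have left: "\<psi> \<circ> \<phi> \<in> I" and right: "\<phi> \<circ> \<psi> \<in> I" if "\<phi> \<in> I" "\<psi> \<in> diffops scale" for \<phi> \<psi>
    using I_l_closed[of \<phi> \<psi>] I_r_closed[of \<phi> \<psi>] that by (simp_all add: diffop_ring_def)
  then show "\<phi> \<in> I \<Longrightarrow> \<psi> \<in> diffops scale \<Longrightarrow> \<psi> \<circ> \<phi> \<in> I" by blast
  have diff: "(\<lambda>s. \<alpha> s - \<beta> s) \<in> I" if "\<alpha> \<in> I" "\<beta> \<in> I" for \<alpha> \<beta>
    using additive_subgroup.a_closed[OF ideal.axioms(1)[OF assms] that(1)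
        left[OF that(2) mult_left_in_diffops[of "- 1"]]]
    by (simp add: diffop_ring_def)
  show "bracket \<psi> \<phi> \<in> I" "bracket \<phi> \<psi> \<in> I" if "\<phi> \<in> I" "\<psi> \<in> diffops scale"
    using diff[OF left[OF that] right[OF that]] diff[OF right[OF that] left[OF that]]
    by (simp_all add: bracket_def)
qed

end

section \<open>Linear maps on the free algebra\<close>

interpretation fa: assoc_algebra "fscale :: 'k::field \<Rightarrow> ('v, 'k) free_algebra \<Rightarrow> _"
  by (rule assoc_algebra_fscale)

definition monomial :: "'v list \<Rightarrow> ('v, 'k::field) free_algebra"
  where "monomial w = Poly_Mapping.single (Word w) 1"

abbreviation letter :: "'v \<Rightarrow> ('v, 'k::field) free_algebra"
  where "letter i \<equiv> monomial [i]"

lemma monomial_Nil: "monomial [] = 1"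
  by (simp add: monomial_def flip: zero_free_monoid_def)

lemma letter_mult_monomial: "letter i * monomial w = monomial (i # w)"
  by (simp add: monomial_def mult_single plus_free_monoid_def)

lemma monomial_expansion:
  "p = (\<Sum>u\<in>Poly_Mapping.keys p. fscale (Poly_Mapping.lookup p u) (monomial (letters u)))"
  by (rule poly_mapping_eqI)
    (auto simp: lookup_sum lookup_fscale monomial_def lookup_single when_def if_distrib
      in_keys_iff cong: if_cong)

lemma free_algebra_induct [case_names monomial add scale]:
  assumes "\<And>w. P (monomial w)" and add: "\<And>p q. P p \<Longrightarrow> P q \<Longrightarrow> P (p + q)"
    and scale: "\<And>c p. P p \<Longrightarrow> P (fscale c p)"
  shows "P p"
proof -
  have "P 0" using scale[OF assms(1), of 0] by (simp add: fa.scale_zero_left)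
  then have "P (\<Sum>u\<in>A. fscale (f u) (monomial (letters u)))" for A f
    by (induction A rule: infinite_finite_induct) (auto intro: assms)
  then show ?thesis using monomial_expansion[of p] by metis
qed

lemma Homk_eqI:
  assumes "\<phi> \<in> Homk fscale" "\<psi> \<in> Homk fscale" "\<And>w. \<phi> (monomial w) = \<psi> (monomial w)"
  shows "\<phi> = \<psi>"
proof
  show "\<phi> p = \<psi> p" for p
    by (induction p rule: free_algebra_induct)
      (simp_all add: assms fa.Homk_add[OF assms(1)] fa.Homk_add[OF assms(2)]
        fa.Homk_scale[OF assms(1)] fa.Homk_scale[OF assms(2)])
qed

text \<open>
  On the free algebra, the order of an operator can be tested on the letters.
\<close>
lemma commut_mem_if_letters:
  assumes "subbimodule fscale M" "\<phi> \<in> Homk fscale" "\<And>i. commut \<phi> (letter i) \<in> M"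
  shows "commut \<phi> r \<in> M"
proof (induction r rule: free_algebra_induct)
  case (monomial w)
  show ?case
  proof (induction w)
    case Nil
    show ?case
      using fa.commut_one_mem[OF assms(1,2)] by (simp add: monomial_Nil)
  next
    case (Cons i w)
    then show ?case
      using fa.commut_mult_mem[OF assms(1,2) assms(3)] by (simp add: letter_mult_monomial[of i w, symmetric])
  qed
qed (use fa.commut_add_mem[OF assms(1,2)] fa.commut_scale_mem[OF assms(1,2)] in auto)

definition linear_extension ::
  "('v list \<Rightarrow> ('v, 'k::field) free_algebra) \<Rightarrow> ('v, 'k) free_algebra \<Rightarrow> ('v, 'k) free_algebra"
  where "linear_extension f p =
    (\<Sum>u\<in>Poly_Mapping.keys p. fscale (Poly_Mapping.lookup p u) (f (letters u)))"

lemma linear_extension_eq_sum: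
  assumes "finite A" "Poly_Mapping.keys p \<subseteq> A"
  shows "linear_extension f p = (\<Sum>u\<in>A. fscale (Poly_Mapping.lookup p u) (f (letters u)))"
  unfolding linear_extension_def using assms
  by (intro sum.mono_neutral_left) (auto simp: in_keys_iff)

lemma linear_extension_Homk:
  fixes f :: "'v list \<Rightarrow> ('v, 'k::field) free_algebra"
  shows "linear_extension f \<in> Homk fscale"
  unfolding fa.mem_Homk_iff
proof (intro conjI allI)
  fix p q :: "('v, 'k) free_algebra" and c
  let ?A = "Poly_Mapping.keys p \<union> Poly_Mapping.keys q"
  have "Poly_Mapping.keys (p + q) \<subseteq> ?A" by (rule Poly_Mapping.keys_add)
  then show "linear_extension f (p + q) = linear_extension f p + linear_extension f q"
    by (simp add: linear_extension_eq_sum[of ?A] lookup_add fa.scale_left_distrib sum.distrib)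
  have "Poly_Mapping.keys (fscale c p) \<subseteq> Poly_Mapping.keys p"
    by (auto simp: in_keys_iff lookup_fscale)
  then have "linear_extension f (fscale c p) =
      (\<Sum>u\<in>Poly_Mapping.keys p. fscale (c * Poly_Mapping.lookup p u) (f (letters u)))"
    by (simp add: linear_extension_eq_sum[of "Poly_Mapping.keys p"] lookup_fscale)
  then show "linear_extension f (fscale c p) = fscale c (linear_extension f p)"
    by (simp add: linear_extension_def fa.scale_sum_right)
qed

lemma linear_extension_monomial: "linear_extension f (monomial w) = f w"
  by (simp add: linear_extension_def monomial_def)

section \<open>Erasing scattered subwords\<close>

text \<open>
  The sum of all words left after erasing from the second word a scattered subword equal to the
  first. The occurrences in \<open>i # w\<close> are those in \<open>w\<close> and, if \<open>i = j\<close>, those that start at \<open>i\<close>.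
\<close>
fun delete_word :: "'v list \<Rightarrow> 'v list \<Rightarrow> ('v, 'k::field) free_algebra"
  where
    "delete_word [] w = monomial w"
  | "delete_word (j # J) [] = 0"
  | "delete_word (j # J) (i # w) =
      letter i * delete_word (j # J) w + (if i = j then delete_word J w else 0)"

definition delete :: "'v list \<Rightarrow> ('v, 'k::field) free_algebra \<Rightarrow> ('v, 'k) free_algebra"
  where "delete J = linear_extension (delete_word J)"

lemma delete_Homk: "delete J \<in> Homk fscale"
  unfolding delete_def by (rule linear_extension_Homk)

lemmas delete_linear =
  fa.Homk_add[OF delete_Homk] fa.Homk_scale[OF delete_Homk] fa.Homk_zero[OF delete_Homk]

lemma delete_monomial: "delete J (monomial w) = delete_word J w"
  unfolding delete_def by (rule linear_extension_monomial)

lemma delete_Nil: "delete [] = id"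
  by (rule Homk_eqI) (simp_all add: delete_monomial fa.mem_Homk_iff delete_linear)

lemma delete_one: "J \<noteq> [] \<Longrightarrow> delete J 1 = 0"
  using delete_monomial[of J "[]"] by (cases J) (simp_all add: monomial_Nil)

lemma commut_delete_Nil: "commut (delete []) r = (\<lambda>_. 0)"
  by (simp add: delete_Nil commut_def ract_def lact_def)

lemma commut_Homk: "\<phi> \<in> Homk fscale \<Longrightarrow> commut \<phi> r \<in> Homk fscale"
  unfolding fa.commut_eq_bracket by (intro fa.bracket_Homk fa.Homk_mult_left)

text \<open>
  The recursion defining \<open>delete_word\<close>, read as a statement on operators. With
  \<open>commut_delete_Nil\<close>, it exhibits \<open>delete J\<close> as a differential operator whose order is at most
  the length of \<open>J\<close>.
\<close>
lemma commut_delete_Cons: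
  "commut (delete (j # J)) (letter i) = (if i = j then delete J else (\<lambda>_. 0))"
proof (rule Homk_eqI)
  show "(if i = j then delete J else (\<lambda>_. 0)) \<in> Homk fscale"
    by (simp add: fa.mem_Homk_iff delete_linear)
  show "commut (delete (j # J)) (letter i) \<in> Homk fscale"
    by (intro commut_Homk delete_Homk)
qed (simp add: commut_def ract_def lact_def letter_mult_monomial delete_monomial)

lemma delete_in_diffops_below:
  "(delete J :: ('v, 'k::field) free_algebra \<Rightarrow> _) \<in> fa.diffops_below (Suc (length J))"
proof (induction J)
  case Nil
  show ?case
    unfolding fa.diffops_below_Suc
    by (intro fa.diffop_step_generator delete_Homk) (simp add: commut_delete_Nil fa.diffops_below_zero)
next
  case (Cons j J)
  have "commut (delete (j # J)) r \<in> fa.diffops_below (Suc (length J))"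
    for r :: "('v, 'k) free_algebra"
    by (rule commut_mem_if_letters[OF fa.subbimodule_diffops_below delete_Homk])
      (simp add: commut_delete_Cons fa.diffops_below_zero Cons)
  then show ?case
    unfolding fa.diffops_below_Suc[of "length (j # J)"]
    by (intro fa.diffop_step_generator delete_Homk) simp
qed

lemma delete_in_diffops: "delete J \<in> diffops fscale"
  unfolding fa.diffops_eq_below using delete_in_diffops_below by blast

lemma delete_letter_mult:
  "delete J (letter i * p) = letter i * delete J p +
    (case J of [] \<Rightarrow> 0 | j # J' \<Rightarrow> if i = j then delete J' p else 0)"
proof (cases J)
  case (Cons j J')
  then show ?thesis
    using fun_cong[OF commut_delete_Cons[of j J' i], of p]
    by (simp add: commut_def ract_def lact_def diff_eq_eq add.commute split: if_splits)
qed (simp add: delete_Nil)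

lemma delete_delete_commute: "delete J (delete K p) = delete K (delete J p)"
proof (induction p rule: free_algebra_induct)
  case (monomial w)
  show ?case
  proof (induction w arbitrary: J K)
    case Nil
    show ?case
      by (cases "J = []"; cases "K = []")
        (simp_all add: monomial_Nil delete_Nil delete_one delete_linear)
  next
    case (Cons i w)
    then show ?case
      by (auto simp: delete_letter_mult delete_linear delete_Nil
          letter_mult_monomial[of i w, symmetric] split: list.split)
  qed
qed (simp_all add: delete_linear)

lemma lookup_monomial: "Poly_Mapping.lookup (monomial w) (Word u) = (1 when w = u)"
  by (simp add: monomial_def lookup_single when_def)

lemma lookup_monomial_zero: "Poly_Mapping.lookup (monomial w) 0 = (1 when w = [])"
  unfolding zero_free_monoid_def by (rule lookup_monomial)

lemma lookup_letter_mult_zero: "Poly_Mapping.lookup (letter i * p) 0 = 0"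
  by (induction p rule: free_algebra_induct)
    (simp_all add: letter_mult_monomial lookup_monomial_zero distrib_left lookup_add fa.scale_mult_right lookup_fscale)

text \<open>
  A scattered subword equal to \<open>J\<close> whose removal leaves nothing is the whole word.
\<close>
lemma lookup_delete_zero:
  fixes p :: "('v, 'k::field) free_algebra"
  shows "Poly_Mapping.lookup (delete J p) 0 = Poly_Mapping.lookup p (Word J)"
proof (induction p rule: free_algebra_induct)
  case (monomial w)
  have "Poly_Mapping.lookup (delete_word J w :: ('v, 'k) free_algebra) 0 = (1 when w = J)"
    by (induction J w rule: delete_word.induct)
      (auto simp: lookup_add lookup_letter_mult_zero lookup_monomial_zero when_def)
  then show ?case
    by (simp add: delete_monomial lookup_monomial when_def eq_commute)
qed (simp_all add: delete_linear lookup_add lookup_fscale)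

section \<open>Degrees\<close>

definition degrees_in :: "nat set \<Rightarrow> ('v, 'k::field) free_algebra \<Rightarrow> bool"
  where "degrees_in D p \<longleftrightarrow> (\<forall>u\<in>Poly_Mapping.keys p. length (letters u) \<in> D)"

lemma degrees_in_zero: "degrees_in D 0"
  by (simp add: degrees_in_def)

lemma degrees_in_empty: "degrees_in {} p \<longleftrightarrow> p = 0"
  by (simp add: degrees_in_def)

lemma degrees_in_mono: "degrees_in D p \<Longrightarrow> D \<subseteq> E \<Longrightarrow> degrees_in E p"
  by (auto simp: degrees_in_def)

lemma degrees_in_add: "degrees_in D p \<Longrightarrow> degrees_in D q \<Longrightarrow> degrees_in D (p + q)"
  using Poly_Mapping.keys_add[of p q] by (auto simp: degrees_in_def)

lemma degrees_in_scale: "degrees_in D p \<Longrightarrow> degrees_in D (fscale c p)"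
  by (auto simp: degrees_in_def in_keys_iff lookup_fscale)

lemma degrees_in_mult:
  assumes "degrees_in A p" "degrees_in B q" "\<And>a b. a \<in> A \<Longrightarrow> b \<in> B \<Longrightarrow> a + b \<in> C"
  shows "degrees_in C (p * q)"
  unfolding degrees_in_def
proof
  fix u assume "u \<in> Poly_Mapping.keys (p * q)"
  then obtain a b where "u = a + b" "a \<in> Poly_Mapping.keys p" "b \<in> Poly_Mapping.keys q"
    using Poly_Mapping.keys_mult[of p q] by auto
  with assms show "length (letters u) \<in> C"
    by (auto simp: degrees_in_def plus_free_monoid_def)
qed

lemma degrees_in_monomial: "degrees_in D (monomial w) \<longleftrightarrow> length w \<in> D"
  by (simp add: degrees_in_def monomial_def)

lemma degrees_in_letter_mult:
  "degrees_in A p \<Longrightarrow> (\<And>a. a \<in> A \<Longrightarrow> Suc a \<in> C) \<Longrightarrow> degrees_in C (letter i * p)"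
  by (rule degrees_in_mult[of "{1}" _ A]) (auto simp: degrees_in_monomial)

lemma degrees_in_Homk:
  assumes "\<phi> \<in> Homk fscale" "degrees_in D p"
    "\<And>w. length w \<in> D \<Longrightarrow> degrees_in E (\<phi> (monomial w))"
  shows "degrees_in E (\<phi> p)"
proof -
  have "degrees_in E (sum f A)" if "\<And>a. a \<in> A \<Longrightarrow> degrees_in E (f a)" for f A
    using that by (induction A rule: infinite_finite_induct) (auto simp: degrees_in_zero degrees_in_add)
  note degrees_in_sum = this
  have "\<phi> p =
      (\<Sum>u\<in>Poly_Mapping.keys p. fscale (Poly_Mapping.lookup p u) (\<phi> (monomial (letters u))))"
    by (subst monomial_expansion[of p])
      (simp add: fa.Homk_sum[OF assms(1)] fa.Homk_scale[OF assms(1)])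
  also have "degrees_in E \<dots>"
    using assms(2,3) by (intro degrees_in_sum degrees_in_scale) (auto simp: degrees_in_def)
  finally show ?thesis .
qed

lemma degrees_in_bounded:
  obtains d where "degrees_in {..<d} p"
proof -
  have "\<exists>d. \<forall>n\<in>(length \<circ> letters) ` Poly_Mapping.keys p. n < d"
    by (subst finite_nat_set_iff_bounded[symmetric]) simp
  then show thesis using that by (auto simp: degrees_in_def)
qed

lemma delete_lowers_degree:
  assumes "K \<noteq> []" "degrees_in {..<d} p"
  shows "degrees_in {..<d - 1} (delete K p)"
proof (rule degrees_in_Homk[OF delete_Homk assms(2)])
  have le: "degrees_in {..length w} (delete_word J w)" for J w :: "'a list"
    by (induction J w rule: delete_word.induct)
      (auto simp: degrees_in_monomial degrees_in_zero
        intro!: degrees_in_add intro: degrees_in_letter_mult degrees_in_mono)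
  have lt: "degrees_in {..<length w} (delete_word (j # J) w)" for j J and w :: "'a list"
    by (induction w)
      (auto simp: degrees_in_zero intro!: degrees_in_add
        intro: degrees_in_letter_mult degrees_in_mono[OF le])
  fix w :: "'a list" assume "length w \<in> {..<d}"
  then show "degrees_in {..<d - 1} (delete K (monomial w))"
    using assms(1) by (cases K) (auto simp: delete_monomial intro: degrees_in_mono[OF lt])
qed

section \<open>Nilpotency under commutators with the erasing operators\<close>

primrec iterated_bracket ::
  "'v list list \<Rightarrow> (('v, 'k::field) free_algebra \<Rightarrow> ('v, 'k) free_algebra)
    \<Rightarrow> ('v, 'k) free_algebra \<Rightarrow> ('v, 'k) free_algebra"
  where
    "iterated_bracket [] \<phi> = \<phi>"
  | "iterated_bracket (K # L) \<phi> = fa.bracket (delete K) (iterated_bracket L \<phi>)"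

lemma iterated_bracket_append:
  "iterated_bracket (L @ M) \<phi> = iterated_bracket L (iterated_bracket M \<phi>)"
  by (induction L) simp_all

lemma iterated_bracket_Homk: "\<phi> \<in> Homk fscale \<Longrightarrow> iterated_bracket L \<phi> \<in> Homk fscale"
  by (induction L) (simp_all add: fa.bracket_Homk delete_Homk)

lemma iterated_bracket_zero: "iterated_bracket L (\<lambda>_. 0) = (\<lambda>_. 0)"
  by (induction L) (simp_all add: fa.bracket_zero delete_Homk)

lemma iterated_bracket_add:
  "iterated_bracket L (\<lambda>s. \<phi> s + \<psi> s) =
    (\<lambda>s. iterated_bracket L \<phi> s + iterated_bracket L \<psi> s)"
  by (induction L) (simp_all add: fa.bracket_def delete_linear fun_eq_iff)

text \<open>
  All lists of words arising when a single word of the list, one that starts with \<open>i\<close>, loses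
  this first letter. They index the terms of the commutator of an iterated bracket with the
  letter \<open>i\<close>.
\<close>
primrec strip :: "'v \<Rightarrow> 'v list list \<Rightarrow> 'v list list list"
  where
    "strip i [] = []"
  | "strip i (K # L) =
      (case K of [] \<Rightarrow> [] | k # K' \<Rightarrow> if i = k then [K' # L] else []) @ map ((#) K) (strip i L)"

lemma length_strip: "L' \<in> set (strip i L) \<Longrightarrow> length L' = length L"
  by (induction L arbitrary: L') (auto split: list.splits if_splits)

text \<open>
  The commutator with a letter is a derivation of the algebra of operators; distribute it
  over the iterated bracket and use \<open>commut_delete_Cons\<close>.
\<close>
lemma commut_iterated_bracket:
  assumes "\<phi> \<in> Homk fscale"
  shows "commut (iterated_bracket L \<phi>) (letter i) s =
    (\<Sum>L'\<leftarrow>strip i L. iterated_bracket L' \<phi> s) + iterated_bracket L (commut \<phi> (letter i)) s"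
proof (induction L arbitrary: s)
  case Nil
  show ?case by simp
next
  case (Cons K L)
  let ?A = "iterated_bracket L \<phi>"
  let ?c = "iterated_bracket L (commut \<phi> (letter i))"
  have sum: "fa.bracket (delete K) (\<lambda>s. \<Sum>L'\<leftarrow>M. iterated_bracket L' \<phi> s) s =
      (\<Sum>L'\<leftarrow>M. iterated_bracket (K # L') \<phi> s)" for M s
    by (induction M) (simp_all add: fa.bracket_def delete_linear)
  have "commut (fa.bracket (delete K) ?A) (letter i) s =
      fa.bracket (commut (delete K) (letter i)) ?A s +
      fa.bracket (delete K) (commut ?A (letter i)) s"
    unfolding fa.commut_eq_bracket
    using fa.bracket_bracket[OF delete_Homk iterated_bracket_Homk[OF assms] fa.Homk_mult_left]
    by (rule fun_cong)
  also have "commut ?A (letter i) = (\<lambda>s. (\<Sum>L'\<leftarrow>strip i L. iterated_bracket L' \<phi> s) + ?c s)"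
    using Cons.IH by blast
  also have "fa.bracket (delete K) \<dots> s =
      (\<Sum>L'\<leftarrow>strip i L. iterated_bracket (K # L') \<phi> s) + fa.bracket (delete K) ?c s"
    unfolding sum[of "strip i L" s, symmetric] by (simp add: fa.bracket_def delete_linear)
  also have "fa.bracket (commut (delete K) (letter i)) ?A s =
      (\<Sum>L'\<leftarrow>(case K of [] \<Rightarrow> [] | k # K' \<Rightarrow> if i = k then [K' # L] else []). iterated_bracket L' \<phi> s)"
    using fa.Homk_zero[OF iterated_bracket_Homk[OF assms], of L]
    by (simp add: commut_delete_Nil commut_delete_Cons fa.bracket_def split: list.split)
  finally show ?case
    by (simp add: comp_def add.assoc)
qed

definition bracket_nilpotent ::
  "nat \<Rightarrow> (('v, 'k::field) free_algebra \<Rightarrow> ('v, 'k) free_algebra) \<Rightarrow> bool"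
  where "bracket_nilpotent N \<phi> \<longleftrightarrow> (\<forall>L. length L = N \<longrightarrow> iterated_bracket L \<phi> = (\<lambda>_. 0))"

lemma bracket_nilpotent_0: "bracket_nilpotent 0 \<phi> \<longleftrightarrow> \<phi> = (\<lambda>_. 0)"
  by (simp add: bracket_nilpotent_def)

lemma bracket_nilpotent_Suc:
  "bracket_nilpotent (Suc N) \<phi> \<longleftrightarrow> (\<forall>K. bracket_nilpotent N (fa.bracket (delete K) \<phi>))"
  (is "?L \<longleftrightarrow> ?R")
proof
  show ?R if ?L
    unfolding bracket_nilpotent_def
  proof (intro allI impI)
    fix K and L :: "'a list list" assume "length L = N"
    then have "length (L @ [K]) = Suc N" by simp
    then have "iterated_bracket (L @ [K]) \<phi> = (\<lambda>_. 0)"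
      using \<open>?L\<close> unfolding bracket_nilpotent_def by blast
    then show "iterated_bracket L (fa.bracket (delete K) \<phi>) = (\<lambda>_. 0)"
      by (simp add: iterated_bracket_append)
  qed
  show ?L if ?R
    unfolding bracket_nilpotent_def
  proof (intro allI impI)
    fix L :: "'a list list" assume "length L = Suc N"
    then obtain M K where "L = M @ [K]" "length M = N"
      by (cases L rule: rev_exhaust) auto
    then show "iterated_bracket L \<phi> = (\<lambda>_. 0)"
      using \<open>?R\<close> by (simp add: iterated_bracket_append bracket_nilpotent_def)
  qed
qed

lemma bracket_nilpotent_mono:
  assumes "bracket_nilpotent M \<phi>" "M \<le> N"
  shows "bracket_nilpotent N \<phi>"
  unfolding bracket_nilpotent_def
proof (intro allI impI)
  fix L :: "'a list list" assume "length L = N"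
  have "iterated_bracket (take (N - M) L @ drop (N - M) L) \<phi> = (\<lambda>_. 0)"
    unfolding iterated_bracket_append
    using assms \<open>length L = N\<close> by (simp add: bracket_nilpotent_def iterated_bracket_zero)
  then show "iterated_bracket L \<phi> = (\<lambda>_. 0)" by simp
qed

lemma bracket_nilpotent_add:
  "bracket_nilpotent N \<phi> \<Longrightarrow> bracket_nilpotent N \<psi> \<Longrightarrow> bracket_nilpotent N (\<lambda>s. \<phi> s + \<psi> s)"
  by (simp add: bracket_nilpotent_def iterated_bracket_add)

text \<open>
  The Leibniz rule for the commutator with \<open>delete K\<close>.
\<close>
lemma bracket_nilpotent_comp:
  assumes "bracket_nilpotent M \<phi>" "bracket_nilpotent N \<psi>" "\<phi> \<in> Homk fscale" "\<psi> \<in> Homk fscale"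
  shows "bracket_nilpotent (M + N) (\<phi> \<circ> \<psi>)"
  using assms
proof (induction "M + N" arbitrary: M N \<phi> \<psi>)
  case 0
  then show ?case by (simp add: bracket_nilpotent_0 comp_def)
next
  case (Suc n)
  show ?case
  proof (cases "M = 0 \<or> N = 0")
    case True
    then have "\<phi> \<circ> \<psi> = (\<lambda>_. 0)"
      using Suc.prems by (auto simp: bracket_nilpotent_0 fa.Homk_zero)
    then show ?thesis by (simp add: bracket_nilpotent_def iterated_bracket_zero)
  next
    case False
    have "bracket_nilpotent n (fa.bracket (delete K) (\<phi> \<circ> \<psi>))" for K
    proof -
      obtain M' N' where MN: "M = Suc M'" "N = Suc N'"
        using False by (metis not0_implies_Suc)
      have "bracket_nilpotent (M' + N) (fa.bracket (delete K) \<phi> \<circ> \<psi>)"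
        using Suc.prems Suc.hyps(2)
        by (intro Suc.hyps(1)) (auto simp: MN bracket_nilpotent_Suc fa.bracket_Homk delete_Homk)
      moreover have "bracket_nilpotent (M + N') (\<phi> \<circ> fa.bracket (delete K) \<psi>)"
        using Suc.prems Suc.hyps(2)
        by (intro Suc.hyps(1)) (auto simp: MN bracket_nilpotent_Suc fa.bracket_Homk delete_Homk)
      moreover have "M' + N = n" "M + N' = n" using MN Suc.hyps(2) by auto
      ultimately have "bracket_nilpotent n (fa.bracket (delete K) \<phi> \<circ> \<psi>)"
        "bracket_nilpotent n (\<phi> \<circ> fa.bracket (delete K) \<psi>)" by simp_all
      then show ?thesis
        unfolding fa.bracket_comp[OF delete_Homk Suc.prems(3)] by (rule bracket_nilpotent_add)
    qed
    then show ?thesis by (simp add: bracket_nilpotent_Suc flip: Suc.hyps(2))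
  qed
qed

text \<open>
  The commutator of \<open>delete K\<close> with a letter is zero or again of the form \<open>delete K'\<close>, and these
  operators commute. So letters are killed by two commutators; the rest follows from the closure
  properties.
\<close>
lemma bracket_nilpotent_mult_left:
  fixes r :: "('v, 'k::field) free_algebra"
  shows "\<exists>N. bracket_nilpotent N ((*) r)"
proof (induction r rule: free_algebra_induct)
  case (monomial w)
  show ?case
  proof (induction w)
    case Nil
    have "bracket_nilpotent 1 ((*) (monomial [] :: ('v, 'k) free_algebra))"
      by (simp add: bracket_nilpotent_Suc bracket_nilpotent_0 monomial_Nil fa.bracket_def)
    then show ?case by blast
  next
    case (Cons i w)
    then obtain N where N: "bracket_nilpotent N ((*) (monomial w :: ('v, 'k) free_algebra))" by blast
    \<comment> \<open>The inner commutator is \<open>0\<close> or an operator \<open>delete K'\<close>.\<close>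
    have "fa.bracket (delete J) (commut (delete K) (letter i :: ('v, 'k) free_algebra)) = (\<lambda>_. 0)"
      for J K
      by (cases K) (auto simp: commut_delete_Nil commut_delete_Cons fa.bracket_def delete_linear
          delete_delete_commute)
    then have "bracket_nilpotent 2 ((*) (letter i :: ('v, 'k) free_algebra))"
      by (simp add: numeral_2_eq_2 bracket_nilpotent_Suc bracket_nilpotent_0
          flip: fa.commut_eq_bracket)
    then have "bracket_nilpotent (2 + N) ((*) (letter i :: ('v, 'k) free_algebra) \<circ> (*) (monomial w))"
      using N by (intro bracket_nilpotent_comp fa.Homk_mult_left)
    also have "(*) (letter i) \<circ> (*) (monomial w) = (*) (monomial (i # w))"
      by (auto simp: letter_mult_monomial simp flip: mult.assoc)
    finally show ?case by blast
  qed
next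
  case (add p q)
  then obtain M N where "bracket_nilpotent M ((*) p)" "bracket_nilpotent N ((*) q)" by blast
  then have "bracket_nilpotent (max M N) (\<lambda>s. p * s + q * s)"
    by (intro bracket_nilpotent_add) (auto elim: bracket_nilpotent_mono)
  then show ?case by (auto simp: distrib_right[symmetric])
next
  case (scale c p)
  then obtain N where N: "bracket_nilpotent N ((*) p)" by blast
  have lin: "fscale c \<in> Homk fscale"
    by (simp add: fa.mem_Homk_iff fa.scale_right_distrib mult.commute)
  have "bracket_nilpotent 1 (fscale c)"
    by (simp add: bracket_nilpotent_Suc bracket_nilpotent_0 fa.bracket_def delete_linear)
  then have "bracket_nilpotent (1 + N) (fscale c \<circ> (*) p)"
    using N lin by (intro bracket_nilpotent_comp fa.Homk_mult_left)
  also have "fscale c \<circ> (*) p = (*) (fscale c p)"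
    by (auto simp: fa.scale_mult_left)
  finally show ?case by blast
qed

text \<open>
  For nonempty \<open>K\<close>, \<open>delete K\<close> kills \<open>1\<close>, so at \<open>1\<close> the commutator with \<open>delete K\<close> is just the
  application of \<open>delete K\<close>, which lowers the degree; for empty \<open>K\<close> the commutator vanishes.
\<close>
lemma iterated_bracket_one:
  assumes "\<phi> \<in> Homk fscale" "degrees_in {..<d} (\<phi> 1)"
  shows "degrees_in {..<d - length L} (iterated_bracket L \<phi> 1)"
proof (induction L)
  case (Cons K L)
  show ?case
  proof (cases "K = []")
    case True
    then show ?thesis by (simp add: fa.bracket_def delete_Nil degrees_in_zero)
  next
    case False
    then show ?thesis
      using delete_lowers_degree[OF False Cons.IH]
      by (simp add: fa.bracket_def delete_one fa.Homk_zero[OF iterated_bracket_Homk[OF assms(1)]])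
  qed
qed (use assms in simp)

text \<open>
  This lemma carries nilpotency through the recursive definition of differential operators. The
  iterated brackets of \<open>\<phi>\<close> over lists of \<open>N\<close> words vanish at \<open>1\<close> for reasons of degree. Their
  commutators with a letter are, by \<open>commut_iterated_bracket\<close>, sums of brackets of \<open>\<phi>\<close> over
  lists of the same length, because the contribution of \<open>commut \<phi> (letter i)\<close> is zero. So if
  they all vanish at \<open>w\<close>, then they all vanish at \<open>i # w\<close>. The induction has to treat all lists
  of \<open>N\<close> words simultaneously.
\<close>
lemma bracket_nilpotent_if_commut_letters:
  assumes \<phi>: "\<phi> \<in> Homk fscale"
    and nil: "\<And>i. bracket_nilpotent N (commut \<phi> (letter i))"
    and deg: "degrees_in {..<N} (\<phi> 1)"
  shows "bracket_nilpotent N \<phi>"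
  unfolding bracket_nilpotent_def
proof (intro allI impI Homk_eqI)
  fix L :: "'a list list"
  show "iterated_bracket L \<phi> \<in> Homk fscale" "(\<lambda>_. 0) \<in> Homk fscale"
    using \<phi> by (simp add: iterated_bracket_Homk) (simp add: fa.mem_Homk_iff)
  fix w assume "length L = N"
  then have "iterated_bracket L \<phi> (monomial w) = 0"
  proof (induction w arbitrary: L)
    case Nil
    then show ?case
      using iterated_bracket_one[OF \<phi> deg, of L] by (simp add: degrees_in_empty monomial_Nil)
  next
    case (Cons i w)
    have "iterated_bracket L' \<phi> (monomial w) = 0" if "L' \<in> set (strip i L)" for L'
      using Cons.IH[of L'] Cons.prems length_strip[OF that] by simp
    then have "(\<Sum>L'\<leftarrow>strip i L. iterated_bracket L' \<phi> (monomial w)) = 0"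
      by (simp cong: map_cong)
    then have "commut (iterated_bracket L \<phi>) (letter i) (monomial w) = 0"
      using nil[of i] Cons.prems commut_iterated_bracket[OF \<phi>, of L i "monomial w"]
      by (simp add: bracket_nilpotent_def)
    then show ?case
      using Cons by (simp add: commut_def ract_def lact_def letter_mult_monomial)
  qed
  then show "iterated_bracket L \<phi> (monomial w) = 0" .
qed

lemma diffops_bracket_nilpotent:
  fixes \<phi> :: "('v::finite, 'k::field) free_algebra \<Rightarrow> ('v, 'k) free_algebra"
  assumes "\<phi> \<in> diffops fscale"
  shows "\<exists>N. bracket_nilpotent N \<phi>"
proof -
  let ?S = "{\<phi> \<in> Homk fscale. \<exists>N. bracket_nilpotent N \<phi>}
    :: (('v, 'k) free_algebra \<Rightarrow> ('v, 'k) free_algebra) set"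
  have "diffops fscale \<subseteq> ?S"
  proof (rule fa.diffops_subsetI)
    note Homk = fa.subbimodule_Homk[unfolded subbimodule_def]
    show "subbimodule fscale ?S"
      unfolding subbimodule_def
    proof (intro conjI ballI allI)
      show "(\<lambda>_. 0) \<in> ?S" using Homk by (auto simp: bracket_nilpotent_0 intro: exI[of _ 0])
      fix \<phi> and r :: "('v, 'k) free_algebra" assume \<phi>: "\<phi> \<in> ?S"
      then obtain M where M: "bracket_nilpotent M \<phi>" by blast
      obtain R where R: "bracket_nilpotent R ((*) r)"
        using bracket_nilpotent_mult_left by blast
      have "lact r \<phi> = (*) r \<circ> \<phi>" "ract \<phi> r = \<phi> \<circ> (*) r"
        by (auto simp: lact_def ract_def)
      moreover have "bracket_nilpotent (R + M) ((*) r \<circ> \<phi>)"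
        "bracket_nilpotent (M + R) (\<phi> \<circ> (*) r)"
        using \<phi> M R by (auto intro!: bracket_nilpotent_comp fa.Homk_mult_left)
      ultimately show "lact r \<phi> \<in> ?S" "ract \<phi> r \<in> ?S"
        using \<phi> by (auto simp: fa.Homk_comp fa.Homk_mult_left)
      fix \<psi> assume \<psi>: "\<psi> \<in> ?S"
      then obtain N where "bracket_nilpotent N \<psi>" by blast
      with M have "bracket_nilpotent (max M N) (\<lambda>s. \<phi> s + \<psi> s)"
        by (intro bracket_nilpotent_add) (auto elim: bracket_nilpotent_mono)
      then show "(\<lambda>s. \<phi> s + \<psi> s) \<in> ?S" using \<phi> \<psi> Homk by blast
    qed auto
  next
    fix \<phi> :: "('v, 'k) free_algebra \<Rightarrow> ('v, 'k) free_algebra"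
    assume \<phi>: "\<phi> \<in> Homk fscale" and "\<And>r. commut \<phi> r \<in> ?S"
    then have "\<forall>i. \<exists>N. bracket_nilpotent N (commut \<phi> (letter i))" by blast
    then obtain f where f: "\<And>i. bracket_nilpotent (f i) (commut \<phi> (letter i))" by metis
    obtain d where d: "degrees_in {..<d} (\<phi> 1)" by (rule degrees_in_bounded)
    \<comment> \<open>As there are finitely many letters, one exponent serves all of them.\<close>
    define N where "N = max d (Max (range f))"
    have "f i \<le> N" for i by (simp add: N_def le_max_iff_disj)
    then have "bracket_nilpotent N (commut \<phi> (letter i))" for i
      using f bracket_nilpotent_mono by blast
    moreover have "degrees_in {..<N} (\<phi> 1)"
      using d by (rule degrees_in_mono) (auto simp: N_def)
    ultimately have "bracket_nilpotent N \<phi>"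
      using \<phi> bracket_nilpotent_if_commut_letters by blast
    then show "\<phi> \<in> ?S" using \<phi> by blast
  qed
  then show ?thesis using assms by blast
qed

section \<open>Differential operators shorten words by a bounded amount\<close>

definition degree_loss_le ::
  "nat \<Rightarrow> (('v, 'k::field) free_algebra \<Rightarrow> ('v, 'k) free_algebra) \<Rightarrow> bool"
  where "degree_loss_le m \<phi> \<longleftrightarrow> (\<forall>k p. degrees_in {k + m..} p \<longrightarrow> degrees_in {k..} (\<phi> p))"

lemma degree_loss_le_mono:
  assumes "degree_loss_le m \<phi>" "m \<le> n"
  shows "degree_loss_le n \<phi>"
  unfolding degree_loss_le_def
proof (intro allI impI)
  fix k and p :: "('a, 'b) free_algebra" assume "degrees_in {k + n..} p"
  then have "degrees_in {k + m..} p"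
    by (rule degrees_in_mono) (use assms(2) in auto)
  with assms(1) show "degrees_in {k..} (\<phi> p)"
    by (simp add: degree_loss_le_def)
qed

text \<open>
  In \<open>\<phi>(iw) = i \<phi>(w) + [\<phi>, i](w)\<close> the first term loses no more degree than \<open>\<phi>(w)\<close>. The second
  term loses one degree more than \<open>[\<phi>, i]\<close> does, since \<open>w\<close> is shorter than \<open>iw\<close>; this is the
  reason for the successor.
\<close>
lemma degree_loss_le_if_commut_letters:
  assumes \<phi>: "\<phi> \<in> Homk fscale" and loss: "\<And>i. degree_loss_le m (commut \<phi> (letter i))"
  shows "degree_loss_le (Suc m) \<phi>"
  unfolding degree_loss_le_def
proof (intro allI impI)
  fix k :: nat and p :: "('a, 'b) free_algebra" assume p: "degrees_in {k + Suc m..} p"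
  have word: "degrees_in {k..} (\<phi> (monomial w))" if "k + Suc m \<le> length w" for k w
    using that
  proof (induction w arbitrary: k)
    case (Cons i w)
    have "degrees_in {k..} (letter i * \<phi> (monomial w))"
    proof (cases k)
      case (Suc k')
      then show ?thesis
        using Cons.prems by (intro degrees_in_letter_mult[OF Cons.IH[of k']]) auto
    qed (simp add: degrees_in_def)
    moreover have "degrees_in {k..} (commut \<phi> (letter i) (monomial w))"
      using loss[of i] Cons.prems by (auto simp: degree_loss_le_def degrees_in_monomial)
    ultimately have "degrees_in {k..} (letter i * \<phi> (monomial w) + commut \<phi> (letter i) (monomial w))"
      by (rule degrees_in_add)
    then show ?case
      by (simp add: commut_def ract_def lact_def letter_mult_monomial)
  qed simp
  show "degrees_in {k..} (\<phi> p)"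
    by (rule degrees_in_Homk[OF \<phi> p]) (simp add: word)
qed

lemma diffops_degree_loss:
  fixes \<phi> :: "('v::finite, 'k::field) free_algebra \<Rightarrow> ('v, 'k) free_algebra"
  assumes "\<phi> \<in> diffops fscale"
  shows "\<exists>m. degree_loss_le m \<phi>"
proof -
  let ?S = "{\<phi> \<in> Homk fscale. \<exists>m. degree_loss_le m \<phi>}
    :: (('v, 'k) free_algebra \<Rightarrow> ('v, 'k) free_algebra) set"
  have "diffops fscale \<subseteq> ?S"
  proof (rule fa.diffops_subsetI)
    note Homk = fa.subbimodule_Homk[unfolded subbimodule_def]
    show "subbimodule fscale ?S"
      unfolding subbimodule_def
    proof (intro conjI ballI allI)
      show "(\<lambda>_. 0) \<in> ?S" using Homk by (auto simp: degree_loss_le_def degrees_in_zero)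
      fix \<phi> and r :: "('v, 'k) free_algebra" assume \<phi>: "\<phi> \<in> ?S"
      then obtain m where m: "degree_loss_le m \<phi>" by blast
      have "degrees_in {k..} (r * q)" if "degrees_in {k..} q" for k q
        using that by (intro degrees_in_mult[of UNIV r "{k..}"]) (auto simp: degrees_in_def)
      then have "degree_loss_le m (lact r \<phi>)" "degree_loss_le m (ract \<phi> r)"
        using m by (auto simp: degree_loss_le_def lact_def ract_def)
      then show "lact r \<phi> \<in> ?S" "ract \<phi> r \<in> ?S"
        using \<phi> Homk by auto
      fix \<psi> assume \<psi>: "\<psi> \<in> ?S"
      then obtain n where "degree_loss_le n \<psi>" by blast
      with m have "degree_loss_le (max m n) \<phi>" "degree_loss_le (max m n) \<psi>"
        by (auto elim: degree_loss_le_mono)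
      then have "degree_loss_le (max m n) (\<lambda>s. \<phi> s + \<psi> s)"
        unfolding degree_loss_le_def by (blast intro: degrees_in_add)
      then show "(\<lambda>s. \<phi> s + \<psi> s) \<in> ?S" using \<phi> \<psi> Homk by blast
    qed auto
  next
    fix \<phi> :: "('v, 'k) free_algebra \<Rightarrow> ('v, 'k) free_algebra"
    assume \<phi>: "\<phi> \<in> Homk fscale" and "\<And>r. commut \<phi> r \<in> ?S"
    then have "\<forall>i. \<exists>m. degree_loss_le m (commut \<phi> (letter i))" by blast
    then obtain f where f: "\<And>i. degree_loss_le (f i) (commut \<phi> (letter i))" by metis
    have "degree_loss_le (Max (range f)) (commut \<phi> (letter i))" for i
      by (rule degree_loss_le_mono[OF f]) simp
    then have "degree_loss_le (Suc (Max (range f))) \<phi>"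
      using \<phi> degree_loss_le_if_commut_letters by blast
    then show "\<phi> \<in> ?S" using \<phi> by blast
  qed
  then show ?thesis using assms by blast
qed

section \<open>Nonzero ideals contain the identity\<close>

text \<open>
  The coefficient of \<open>J\<close> in \<open>\<phi> p\<close> is the constant coefficient of
  \<open>delete J (\<phi> p) = \<phi> (delete J p)\<close>. Hence \<open>\<phi>\<close> is determined by the constant coefficients of its
  values on words, and \<open>m\<close> bounds the length of the words where these are nonzero. The commutator
  with a letter lowers this bound and still commutes with all \<open>delete K\<close>. If \<open>\<phi>\<close> commutes
  with all letters, then it is right multiplication by \<open>\<phi> 1\<close>, and \<open>\<phi> 1\<close> is a scalar because every
  \<open>delete K\<close> with \<open>K\<close> nonempty kills it.
\<close>
lemma ideal_contains_id_if_commutes_with_deletes: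
  assumes I: "ideal I (diffop_ring fscale)"
    and "\<phi> \<in> I" "\<phi> \<noteq> (\<lambda>_. 0)" "\<And>K. fa.bracket (delete K) \<phi> = (\<lambda>_. 0)"
    and "\<And>w. m \<le> length w \<Longrightarrow> Poly_Mapping.lookup (\<phi> (monomial w)) 0 = 0"
  shows "id \<in> I"
  using assms(2-)
proof (induction m arbitrary: \<phi>)
  case 0
  have \<phi>: "\<phi> \<in> Homk fscale"
    using fa.diffop_ideal_subset[OF I] 0 fa.diffops_Homk by blast
  have "Poly_Mapping.lookup (\<phi> p) 0 = 0" for p
    using 0
    by (induction p rule: free_algebra_induct)
      (simp_all add: fa.Homk_add[OF \<phi>] fa.Homk_scale[OF \<phi>] lookup_add lookup_fscale)
  moreover have "delete K (\<phi> p) = \<phi> (delete K p)" for K p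
    using fun_cong[OF 0(3)[of K], of p] by (simp add: fa.bracket_def)
  ultimately have "Poly_Mapping.lookup (\<phi> p) u = 0" for p u
    using lookup_delete_zero[of "letters u" "\<phi> p"] by simp
  then have "\<phi> = (\<lambda>_. 0)" by (intro ext poly_mapping_eqI) simp
  with 0 show ?case by blast
next
  case (Suc m)
  have \<phi>: "\<phi> \<in> Homk fscale"
    using fa.diffop_ideal_subset[OF I] Suc fa.diffops_Homk by blast
  have comm: "delete K (\<phi> p) = \<phi> (delete K p)" for K p
    using fun_cong[OF Suc.prems(3)[of K], of p] by (simp add: fa.bracket_def)
  show ?case
  proof (cases "\<forall>i. commut \<phi> (letter i) = (\<lambda>_. 0)")
    case False
    then obtain i where i: "commut \<phi> (letter i) \<noteq> (\<lambda>_. 0)" by blast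
    show ?thesis
    proof (rule Suc.IH[OF _ i])
      show "commut \<phi> (letter i) \<in> I"
        unfolding fa.commut_eq_bracket
        by (intro fa.diffop_ideal_bracket_right[OF I] Suc.prems fa.mult_left_in_diffops)
      show "fa.bracket (delete K) (commut \<phi> (letter i)) = (\<lambda>_. 0)" for K
        by (simp add: fun_eq_iff fa.bracket_def commut_def ract_def lact_def comm delete_letter_mult
            delete_linear fa.Homk_diff[OF delete_Homk] fa.Homk_add[OF \<phi>] fa.Homk_zero[OF \<phi>]
            split: list.split)
      fix w :: "'a list" assume "m \<le> length w"
      then show "Poly_Mapping.lookup (commut \<phi> (letter i) (monomial w)) 0 = 0"
        using Suc.prems(4)[of "i # w"]
        by (simp add: commut_def ract_def lact_def letter_mult_monomial lookup_minus
            lookup_letter_mult_zero)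
    qed
  next
    case True
    define c where "c = Poly_Mapping.lookup (\<phi> 1) 0"
    have one: "\<phi> 1 = fscale c 1"
    proof (rule poly_mapping_eqI)
      fix u
      have "Poly_Mapping.lookup (\<phi> 1) u = Poly_Mapping.lookup (\<phi> (delete (letters u) 1)) 0"
        using lookup_delete_zero[of "letters u" "\<phi> 1"] by (simp add: comm)
      then show "Poly_Mapping.lookup (\<phi> 1) u = Poly_Mapping.lookup (fscale c 1) u"
        by (cases u)
          (simp add: c_def delete_one fa.Homk_zero[OF \<phi>] lookup_fscale lookup_one
            zero_free_monoid_def delete_Nil when_def)
    qed
    have scalar: "\<phi> (monomial w) = fscale c (monomial w)" for w
    proof (induction w)
      case (Cons i w)
      have "\<phi> (letter i * monomial w) = letter i * \<phi> (monomial w)"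
        using True by (simp add: fun_eq_iff commut_def ract_def lact_def)
      then show ?case
        using Cons by (simp add: letter_mult_monomial fa.scale_mult_right)
    qed (simp add: monomial_Nil one)
    have "\<phi> = fscale c"
      by (rule Homk_eqI[OF \<phi>])
        (simp_all add: scalar fa.mem_Homk_iff fa.scale_right_distrib mult.commute)
    moreover from this have "c \<noteq> 0"
      using Suc.prems(2) by (auto simp: fun_eq_iff fa.scale_zero_left)
    ultimately have "(*) (fscale (inverse c) 1) \<circ> \<phi> = id"
      by (auto simp: fa.scale_mult_left)
    then show ?thesis
      using fa.diffop_ideal_comp_left[OF I Suc.prems(1) fa.mult_left_in_diffops] by metis
  qed
qed

lemma nonzero_ideal_contains_id:
  fixes \<phi> :: "('v::finite, 'k::field) free_algebra \<Rightarrow> ('v, 'k) free_algebra"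
  assumes I: "ideal I (diffop_ring fscale)" and "\<phi> \<in> I" "\<phi> \<noteq> (\<lambda>_. 0)"
  shows "id \<in> I"
proof -
  obtain N where "bracket_nilpotent N \<phi>"
    using diffops_bracket_nilpotent fa.diffop_ideal_subset[OF I] assms(2) by blast
  then show ?thesis
    using assms(2,3)
  proof (induction N arbitrary: \<phi>)
    case 0
    then show ?case by (simp add: bracket_nilpotent_0)
  next
    case (Suc N)
    show ?case
    proof (cases "\<forall>K. fa.bracket (delete K) \<phi> = (\<lambda>_. 0)")
      case False
      then obtain K where "fa.bracket (delete K) \<phi> \<noteq> (\<lambda>_. 0)" by blast
      moreover have "fa.bracket (delete K) \<phi> \<in> I"
        by (intro fa.diffop_ideal_bracket_left[OF I] Suc.prems delete_in_diffops)
      ultimately show ?thesis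
        using Suc by (auto simp: bracket_nilpotent_Suc)
    next
      case True
      obtain m where m: "degree_loss_le m \<phi>"
        using diffops_degree_loss fa.diffop_ideal_subset[OF I] Suc.prems by blast
      have "Poly_Mapping.lookup (\<phi> (monomial w)) 0 = 0" if "Suc m \<le> length w" for w
      proof -
        have "degrees_in {1..} (\<phi> (monomial w))"
          using m that by (auto simp: degree_loss_le_def degrees_in_monomial)
        then show ?thesis
          by (force simp: degrees_in_def in_keys_iff zero_free_monoid_def)
      qed
      with True Suc.prems show ?thesis
        using ideal_contains_id_if_commutes_with_deletes[OF I, of \<phi> "Suc m"] by blast
    qed
  qed
qed

theorem theorem3p4:
  assumes "CARD('v::finite) > 1"
  shows "simple_ring
    (diffop_ring (fscale :: 'k::field \<Rightarrow> ('v, 'k) free_algebra \<Rightarrow> ('v, 'k) free_algebra))"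
proof -
  let ?D = "diffop_ring (fscale :: 'k \<Rightarrow> ('v, 'k) free_algebra \<Rightarrow> _)"
  interpret ring ?D by (rule fa.ring_diffop_ring)
  show ?thesis
  proof
    fix I assume I: "ideal I ?D"
    then interpret ideal I ?D .
    show "I = {\<zero>\<^bsub>?D\<^esub>} \<or> I = carrier ?D"
    proof (cases "I \<subseteq> {\<zero>\<^bsub>?D\<^esub>}")
      case True
      then show ?thesis using additive_subgroup.zero_closed[OF ideal.axioms(1)[OF I]] by blast
    next
      case False
      then obtain \<phi> where "\<phi> \<in> I" "\<phi> \<noteq> (\<lambda>_. 0)" by (auto simp: diffop_ring_def)
      then have "id \<in> I" by (rule nonzero_ideal_contains_id[OF I])
      then show ?thesis using one_imp_carrier by (simp add: diffop_ring_def)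
    qed
  qed
qed

end
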